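(* Let $\nu(n)>0$ be a sequence with $\nu(n)\to\infty$ monotonically as $n\to\infty$. Then there exist a sequence $\{a_n\}_{n=0}^\infty$ of real numbers in $(-1,1)$ and a sequence $\{\omega_n\}_{n=0}^\infty$ of independent, rotationally symmetric, $\mathbb{D}$-valued random variables such that, with $\alpha_n=a_n\omega_n$ and $\{\Phi_n\}_{n\ge0}$ the (random) monic orthogonal polynomials on the unit circle with Verblunsky parameters $\{\alpha_n\}$, with probability $1$ there is $\theta^*\in[0,2\pi)$ (depending on the realization) satisfying $$\sup_n|\Phi_n(e^{i\theta^*})|=\infty,$$ and, moreover, with $R_n=\sum_{m=n}^\infty a_m^2$, $$\sum_{n\ge2}\frac{\sqrt{R_n}}{\nu(n)\,n\sqrt{\log n}}<\infty .$$
   Context: $\mathbb{D}=\{z\in\mathbb{C}:|z|<1\}$ and $\mathbb{T}=\{z\in\mathbb{C}:|z|=1\}$. Given Verblunsky parameters $\{\alpha_n\}_{n=0}^\infty\in\mathbb{D}^\infty$, the monic orthogonal polynomials $\Phi_n$ and the reversed polynomials $\Phi_n^*$ are defined by $\Phi_0=\Phi_0^*=1$ and the Szegő recursion $$\Phi_{n+1}(z)=z\Phi_n(z)-\overline{\alpha_n}\,\Phi_n^*(z),\qquad \Phi_{n+1}^*(z)=\Phi_n^*(z)-\alpha_n z\Phi_n(z).$$ For $z\in\mathbb{T}$ one has $\Phi_n^*(z)=z^n\overline{\Phi_n(z)}$. A complex random variable $\omega$ is rotationally symmetric if $e^{it}\omega$ has the same law as $\omega$ for every real $t$. *)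

theory Defs
  imports "HOL-Probability.Probability" "HOL-Computational_Algebra.Polynomial"
begin

(* Monic orthogonal polynomials on the unit circle with Verblunsky parameters \<alpha>, and
   their reversed polynomials, given by the Szego recursion; [:0, 1:] is the polynomial z. *)
fun opuc :: "(nat \<Rightarrow> complex) \<Rightarrow> nat \<Rightarrow> complex poly"
  and opuc_rev :: "(nat \<Rightarrow> complex) \<Rightarrow> nat \<Rightarrow> complex poly" where
  "opuc \<alpha> 0 = 1"
| "opuc_rev \<alpha> 0 = 1"
| "opuc \<alpha> (Suc n) = [:0, 1:] * opuc \<alpha> n - smult (cnj (\<alpha> n)) (opuc_rev \<alpha> n)"
| "opuc_rev \<alpha> (Suc n) = opuc_rev \<alpha> n - smult (\<alpha> n) ([:0, 1:] * opuc \<alpha> n)"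

definition rotationally_symmetric :: "'a measure \<Rightarrow> ('a \<Rightarrow> complex) \<Rightarrow> bool" where
  "rotationally_symmetric M X \<longleftrightarrow>
     X \<in> borel_measurable M \<and>
     (\<forall>t::real. distr M borel (\<lambda>x. exp (\<i> * complex_of_real t) * X x) = distr M borel X)"

(* Only meaningful for square-summable a: infsum is 0 on a divergent sum. *)
definition tail_sq_sum :: "(nat \<Rightarrow> real) \<Rightarrow> nat \<Rightarrow> real" where
  "tail_sq_sum a n = (\<Sum>\<^sub>\<infinity>m\<in>{n..}. (a m)\<^sup>2)"

end

theory Submission
  imports Defs
begin

text \<open>
  Randomness plays a smaller part than one might expect: the Verblunsky parameters can be
  put on a lacunary set of indices in such a way that the orthogonal polynomials are unbounded
  for every choice of their arguments.

  On the unit circle \<open>z \<Phi>\<^sub>n / \<Phi>\<^sub>n\<^sup>*\<close> is unimodular, so it equals \<open>exp (i \<psi>\<^sub>n)\<close> for a real Pruefer phase \<open>\<psi>\<^sub>n\<close>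
  and \<open>\<bar>\<Phi>\<^sub>n\<bar>\<close> is the product of the factors \<open>\<bar>1 - \<alpha>\<^sub>k exp (i \<psi>\<^sub>k)\<bar>\<close>, \<open>k < n\<close> (lemma \<open>norm_opuc_eq_prod\<close>).
  If \<open>\<alpha>\<close> vanishes off a sequence \<open>N\<^sub>i\<close> with \<open>N\<^sub>i\<^sub>+\<^sub>1 \<ge> 9 N\<^sub>i\<close> and is at most \<open>1/5\<close> in modulus, then \<open>\<psi>\<close> at time \<open>N\<^sub>i\<close> is an
  increasing function of the angle with slope at most \<open>2 N\<^sub>i\<close>, while on every interval of length
  at least \<open>\<pi> / (3 N\<^sub>i)\<close> the next phase, at time \<open>N\<^sub>i\<^sub>+\<^sub>1\<close>, makes more than one full turn.  As for lacunary
  trigonometric series, nested intervals then give an angle at which all the factors at once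
  are at least \<open>1 + \<bar>\<alpha>\<bar>/2\<close>.  Hence the polynomials are unbounded there as soon as the sum of the
  moduli of the parameters diverges (theorem \<open>opuc_lacunary_unbounded\<close>).

  It remains to see that divergence of this sum is compatible with the condition on the tails
  \<open>R\<^sub>n\<close>.  Take \<open>N\<^sub>i = 16\<^sup>i\<close> and a sequence \<open>K\<^sub>0 < K\<^sub>1 < \<dots>\<close> at least doubling in each step and
  growing so fast that \<open>\<nu>\<close> is at least a fixed multiple of \<open>2\<^sup>j\<close> from index \<open>16\<close> to the
  power \<open>K\<^sub>j - 1\<close> on; for \<open>K\<^sub>j \<le> i < K\<^sub>j\<^sub>+\<^sub>1\<close> let the coefficient at \<open>16\<^sup>i\<close> be a constant multiple of
  \<open>1 / K\<^sub>j\<^sub>+\<^sub>1\<close>.  Each such block contributes at least a fixed amount to the sum of the moduli, but only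
  \<open>O(1 / K\<^sub>j\<^sub>+\<^sub>1)\<close> to the sum of squares.  So on the corresponding range of \<open>n\<close> one has \<open>R\<^sub>n = O(1 / K\<^sub>j\<^sub>+\<^sub>1)\<close>, and
  since \<open>1 / (n sqrt (log n))\<close> sums to \<open>O(sqrt K\<^sub>j\<^sub>+\<^sub>1)\<close> over this range, the block contributes \<open>O(2\<^sup>-\<^sup>j)\<close> to
  the series of the theorem (lemma \<open>weighted_tail_summable\<close>).

  Independent variables \<open>\<omega>\<^sub>n\<close>, uniformly distributed on the circle of radius \<open>1/2\<close>, make the
  parameters random without affecting their moduli; the exceptional null set is empty.
\<close>

section \<open>Pruefer phases\<close>

text \<open>
  A continuous lift in \<open>\<theta>\<close> of the argument of \<open>z \<Phi>\<^sub>n / \<Phi>\<^sub>n\<^sup>*\<close> at \<open>z = exp (i \<theta>)\<close>.  A recursion step multiplies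
  \<open>\<Phi>\<^sub>n\<^sup>*\<close> by \<open>u = 1 - \<alpha>\<^sub>n exp (i \<psi>\<^sub>n)\<close> and multiplies the quotient by \<open>z cnj u / u\<close>; as \<open>Re u > 0\<close> for \<open>\<bar>\<alpha>\<^sub>n\<bar> < 1\<close>, the
  principal logarithm gives the argument of the latter without any jump.
\<close>
primrec pruefer :: "(nat \<Rightarrow> complex) \<Rightarrow> real \<Rightarrow> nat \<Rightarrow> real" where
  "pruefer \<alpha> \<theta> 0 = \<theta>"
| "pruefer \<alpha> \<theta> (Suc n) =
     \<theta> + pruefer \<alpha> \<theta> n - 2 * Im (Ln (1 - \<alpha> n * cis (pruefer \<alpha> \<theta> n)))"

lemma cnj_eq_cis_Ln:
  assumes "u \<noteq> 0"
  shows "cnj u = cis (- 2 * Im (Ln u)) * u"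
proof -
  have "cnj (Ln u) = \<i> * of_real (- 2 * Im (Ln u)) + Ln u"
    by (simp add: complex_eq_iff)
  then have "exp (cnj (Ln u)) = cis (- 2 * Im (Ln u)) * exp (Ln u)"
    by (simp only: exp_add cis_conv_exp)
  then show ?thesis
    using assms by (simp add: exp_cnj[symmetric])
qed

text \<open>
  With \<open>w = exp (i \<psi>\<^sub>n)\<close> and \<open>u = 1 - \<alpha>\<^sub>n w\<close> the recursion gives \<open>z \<Phi>\<^sub>n\<^sub>+\<^sub>1 = z (w - cnj \<alpha>\<^sub>n) \<Phi>\<^sub>n\<^sup>* = z w cnj u \<Phi>\<^sub>n\<^sup>*\<close>, as
  \<open>w\<close> is unimodular, and \<open>\<Phi>\<^sub>n\<^sub>+\<^sub>1\<^sup>* = u \<Phi>\<^sub>n\<^sup>*\<close>.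
\<close>
lemma opuc_pruefer:
  assumes "\<And>n. cmod (\<alpha> n) < 1"
  shows "cis \<theta> * poly (opuc \<alpha> n) (cis \<theta>)
       = cis (pruefer \<alpha> \<theta> n) * poly (opuc_rev \<alpha> n) (cis \<theta>)"
proof (induction n)
  case 0
  show ?case by simp
next
  case (Suc n)
  define F where "F = poly (opuc \<alpha> n) (cis \<theta>)"
  define G where "G = poly (opuc_rev \<alpha> n) (cis \<theta>)"
  define w where "w = cis (pruefer \<alpha> \<theta> n)"
  define u where "u = 1 - \<alpha> n * w"
  have FG: "cis \<theta> * F = w * G"
    using Suc by (simp add: F_def G_def w_def)
  have ww: "w * cnj w = 1"
    by (simp add: w_def cis_cnj cis_mult)
  have "u \<noteq> 0"
  proof
    assume "u = 0"
    then have "cmod (\<alpha> n * w) = 1" by (simp add: u_def)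
    then show False using assms[of n] by (simp add: w_def norm_mult)
  qed
  have "cis \<theta> * poly (opuc \<alpha> (Suc n)) (cis \<theta>) = cis \<theta> * (w * G - cnj (\<alpha> n) * G)"
    using FG by (simp add: F_def G_def)
  also have "w * G - cnj (\<alpha> n) * G = w * cnj u * G"
    using ww by (simp add: u_def algebra_simps)
  also have "cnj u = cis (- 2 * Im (Ln u)) * u"
    by (rule cnj_eq_cis_Ln) fact
  also have "cis \<theta> * (w * (cis (- 2 * Im (Ln u)) * u) * G)
           = cis (pruefer \<alpha> \<theta> (Suc n)) * (u * G)"
  proof -
    have "cis (pruefer \<alpha> \<theta> (Suc n)) = cis \<theta> * w * cis (- 2 * Im (Ln u))"
      by (simp add: w_def u_def cis_mult)
    then show ?thesis by simp
  qed
  also have "u * G = poly (opuc_rev \<alpha> (Suc n)) (cis \<theta>)"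
    using FG by (simp add: F_def G_def u_def algebra_simps)
  finally show ?case .
qed

text \<open>
  Expressing \<open>z \<Phi>\<^sub>n\<close> through \<open>\<Phi>\<^sub>n\<^sup>*\<close> turns the recursion of the reversed polynomials into multiplication by
  \<open>1 - \<alpha>\<^sub>n exp (i \<psi>\<^sub>n)\<close>, and both polynomials have the same modulus on the circle.
\<close>
lemma norm_opuc_eq_prod:
  assumes "\<And>n. cmod (\<alpha> n) < 1"
  shows "cmod (poly (opuc \<alpha> n) (cis \<theta>))
       = (\<Prod>k<n. cmod (1 - \<alpha> k * cis (pruefer \<alpha> \<theta> k)))"
proof -
  have eq: "cmod (poly (opuc \<alpha> n) (cis \<theta>)) = cmod (poly (opuc_rev \<alpha> n) (cis \<theta>))" for n
    using arg_cong[OF opuc_pruefer[where \<alpha> = \<alpha> and \<theta> = \<theta> and n = n, OF assms], of cmod] by (simp add: norm_mult)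
  have "cmod (poly (opuc_rev \<alpha> n) (cis \<theta>))
      = (\<Prod>k<n. cmod (1 - \<alpha> k * cis (pruefer \<alpha> \<theta> k)))"
  proof (induction n)
    case (Suc n)
    have "poly (opuc_rev \<alpha> (Suc n)) (cis \<theta>)
        = poly (opuc_rev \<alpha> n) (cis \<theta>) * (1 - \<alpha> n * cis (pruefer \<alpha> \<theta> n))"
      using opuc_pruefer[where \<alpha> = \<alpha> and \<theta> = \<theta> and n = n, OF assms] by (simp add: algebra_simps)
    then show ?case using Suc by (simp add: norm_mult)
  qed simp
  then show ?thesis using eq by simp
qed

section \<open>Dependence of the phase on the angle\<close>

lemma cis_lipschitz: "cmod (cis t - cis s) \<le> \<bar>t - s\<bar>"
proof -
  have "cmod (cis t - cis s) \<le> 1 * norm (t - s)"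
  proof (rule differentiable_bound[of UNIV cis "\<lambda>x h. \<i> * (of_real h * cis x)"])
    show "(cis has_derivative (\<lambda>h. \<i> * (of_real h * cis x))) (at x within UNIV)" for x
        by (auto intro!: derivative_eq_intros simp: cis_conv_exp scaleR_conv_of_real algebra_simps)
    show "onorm (\<lambda>h. \<i> * (complex_of_real h * cis x)) \<le> 1" for x
      by (rule onorm_le) (simp add: norm_mult)
  qed auto
  then show ?thesis by simp
qed

text \<open>
  The bound \<open>1/5\<close> on the parameters is chosen to make this Lipschitz constant \<open>1/2\<close>: the phase
  then remains increasing, and a step stretches it at most by the factor \<open>3/2\<close>.
\<close>
lemma Ln_step_lipschitz:
  assumes "cmod \<alpha> \<le> 1/5"
  shows "\<bar>2 * Im (Ln (1 - \<alpha> * cis t)) - 2 * Im (Ln (1 - \<alpha> * cis s))\<bar> \<le> \<bar>t - s\<bar> / 2"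
proof -
  have re: "Re (1 - w) \<ge> 4/5" if "w \<in> cball 0 (1/5)" for w
    using that abs_Re_le_cmod[of w] by simp
  have "cmod (Ln (1 - \<alpha> * cis t) - Ln (1 - \<alpha> * cis s)) \<le> 5/4 * cmod (\<alpha> * cis t - \<alpha> * cis s)"
  proof (rule field_differentiable_bound[where S = "cball 0 (1/5)" and f = "\<lambda>w. Ln (1 - w)"
        and f' = "\<lambda>w. - inverse (1 - w)"])
    fix w :: complex assume w: "w \<in> cball 0 (1/5)"
    have "1 - w \<notin> \<real>\<^sub>\<le>\<^sub>0"
      using re[OF w] by (auto simp: complex_nonpos_Reals_iff)
    then show "((\<lambda>w. Ln (1 - w)) has_field_derivative - inverse (1 - w)) (at w within cball 0 (1/5))"
      by (auto intro!: derivative_eq_intros simp: field_simps)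
    have "cmod (1 - w) \<ge> 4/5"
      using re[OF w] complex_Re_le_cmod[of "1 - w"] by linarith
    then show "cmod (- inverse (1 - w)) \<le> 5/4"
      using le_imp_inverse_le[of "4/5" "cmod (1 - w)"] by (simp add: norm_inverse)
  qed (use assms in \<open>auto simp: norm_mult\<close>)
  also have "\<alpha> * cis t - \<alpha> * cis s = \<alpha> * (cis t - cis s)"
    by (simp add: algebra_simps)
  also have "5/4 * cmod (\<alpha> * (cis t - cis s)) \<le> 5/4 * (1/5 * \<bar>t - s\<bar>)"
    unfolding norm_mult by (intro mult_left_mono mult_mono assms cis_lipschitz) auto
  finally have "cmod (Ln (1 - \<alpha> * cis t) - Ln (1 - \<alpha> * cis s)) \<le> \<bar>t - s\<bar> / 4"
    by simp
  then show ?thesis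
    using abs_Im_le_cmod[of "Ln (1 - \<alpha> * cis t) - Ln (1 - \<alpha> * cis s)"]
    unfolding minus_complex.sel by linarith
qed

lemma pruefer_step:
  assumes "cmod (\<alpha> n) \<le> 1/5" "s \<le> t" "pruefer \<alpha> s n \<le> pruefer \<alpha> t n"
  shows "t - s \<le> pruefer \<alpha> t (Suc n) - pruefer \<alpha> s (Suc n)"
    and "pruefer \<alpha> t (Suc n) - pruefer \<alpha> s (Suc n)
           \<le> (t - s) + 3/2 * (pruefer \<alpha> t n - pruefer \<alpha> s n)"
  using Ln_step_lipschitz[OF assms(1), of "pruefer \<alpha> t n" "pruefer \<alpha> s n"] assms(2,3)
  by (auto simp: abs_if split: if_splits)

lemma pruefer_mono:
  assumes "\<And>n. cmod (\<alpha> n) \<le> 1/5" "s \<le> t"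
  shows "pruefer \<alpha> s n \<le> pruefer \<alpha> t n"
proof (induction n)
  case (Suc n)
  then show ?case using pruefer_step(1)[OF assms(1) assms(2) Suc] assms(2) by linarith
qed (use assms in simp)

lemma pruefer_free_evolution:
  assumes "\<And>k. m \<le> k \<Longrightarrow> k < m + d \<Longrightarrow> \<alpha> k = 0"
  shows "pruefer \<alpha> \<theta> (m + d) = pruefer \<alpha> \<theta> m + real d * \<theta>"
  using assms by (induction d) (auto simp: algebra_simps)

lemma cos_le_minus_half:
  assumes "2*pi/3 \<le> x" "x \<le> 4*pi/3"
  shows "cos x \<le> -1/2"
proof -
  have "cos (pi/3) \<le> cos \<bar>x - pi\<bar>"
    by (rule cos_monotone_0_pi_le) (use assms in \<open>auto simp: abs_if\<close>)
  then show ?thesis by (simp add: cos_60 cos_diff)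
qed

text \<open>
  A phase that increases by a full turn plus \<open>2\<pi>/3\<close> must traverse some arc of length \<open>2\<pi>/3\<close> centred
  at \<open>\<pi>\<close> modulo \<open>2\<pi>\<close>, on which the cosine is at most \<open>-1/2\<close>; the slope bound \<open>D\<close> limits how fast this can
  happen.
\<close>
lemma subinterval_of_large_phase:
  fixes \<psi> :: "real \<Rightarrow> real"
  assumes lip: "\<And>s t. l \<le> s \<Longrightarrow> s \<le> t \<Longrightarrow> t \<le> r \<Longrightarrow> 0 \<le> \<psi> t - \<psi> s \<and> \<psi> t - \<psi> s \<le> D * (t - s)"
    and lr: "l \<le> r" and D: "D > 0"
    and large: "\<psi> r - \<psi> l \<ge> 8*pi/3"
  obtains l' r' where "l \<le> l'" "l' \<le> r'" "r' \<le> r" "r' - l' \<ge> 2*pi/3 / D"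
    "\<And>t. l' \<le> t \<Longrightarrow> t \<le> r' \<Longrightarrow> cos (\<psi> t + \<beta>) \<le> -1/2"
proof -
  \<comment> \<open>\<open>k\<close> numbers the first translate of the arc that starts at or after \<open>\<psi> l + \<beta>\<close>.\<close>
  define k :: int where "k = \<lceil>(\<psi> l + \<beta> - 2*pi/3) / (2*pi)\<rceil>"
  define y1 where "y1 = 2*pi* of_int k + 2*pi/3 - \<beta>"
  define y2 where "y2 = 2*pi* of_int k + 4*pi/3 - \<beta>"
  have "(\<psi> l + \<beta> - 2*pi/3) / (2*pi) \<le> of_int k" "of_int k < (\<psi> l + \<beta> - 2*pi/3) / (2*pi) + 1"
    unfolding k_def by linarith+
  then have k: "\<psi> l + \<beta> - 2*pi/3 \<le> 2*pi* of_int k" "2*pi* of_int k < \<psi> l + \<beta> - 2*pi/3 + 2*pi"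
    by (simp_all add: field_simps)
  have cont: "continuous_on {l..r} \<psi>"
  proof (rule lipschitz_on_continuous_on)
    show "D-lipschitz_on {l..r} \<psi>"
    proof (rule lipschitz_onI)
      fix x y assume "x \<in> {l..r}" "y \<in> {l..r}"
      then show "dist (\<psi> x) (\<psi> y) \<le> D * dist x y"
        using lip[of x y] lip[of y x] by (cases "x \<le> y") (auto simp: dist_real_def)
    qed (use D in simp)
  qed
  have y: "\<psi> l \<le> y1" "y1 \<le> y2" "y2 \<le> \<psi> r"
    using k large pi_gt_zero unfolding y1_def y2_def by (auto simp: field_simps)
  obtain l' where l': "l \<le> l'" "l' \<le> r" "\<psi> l' = y1"
    using IVT'[of \<psi> l y1 r] y cont lr by auto
  have cont': "continuous_on {l'..r} \<psi>"
    by (rule continuous_on_subset[OF cont]) (use l' in auto)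
  obtain r' where r': "l' \<le> r'" "r' \<le> r" "\<psi> r' = y2"
    using IVT'[of \<psi> l' y2 r] y cont' l' by auto
  have "2*pi/3 = \<psi> r' - \<psi> l'"
    using l' r' by (simp add: y1_def y2_def)
  also have "\<dots> \<le> D * (r' - l')"
    using lip[of l' r'] l' r' by simp
  finally have len: "r' - l' \<ge> 2*pi/3 / D"
    using D by (simp add: field_simps)
  have "cos (\<psi> t + \<beta>) \<le> -1/2" if "l' \<le> t" "t \<le> r'" for t
  proof -
    have "\<psi> l' \<le> \<psi> t" "\<psi> t \<le> \<psi> r'"
      using lip[of l' t] lip[of t r'] that l' r' by auto
    then have "cos (\<psi> t + \<beta> - 2*pi* of_int k) \<le> -1/2"
      using l' r' by (intro cos_le_minus_half) (auto simp: y1_def y2_def)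
    also have "cos (\<psi> t + \<beta> - 2*pi* of_int k) = cos (\<psi> t + \<beta>)"
      by (simp add: cos_diff)
    finally show ?thesis .
  qed
  then show thesis using that l' r' len by blast
qed

section \<open>Lacunary Verblunsky parameters\<close>

text \<open>
  After the kick at time \<open>N\<close> the phase advances freely by \<open>\<theta>\<close> in each step, so its dependence on
  the angle is dominated by the length of the gap.
\<close>
lemma pruefer_block:
  assumes small: "\<And>n. cmod (\<alpha> n) \<le> 1/5" and st: "s \<le> t"
    and gap: "\<And>k. N < k \<Longrightarrow> k < N' \<Longrightarrow> \<alpha> k = 0" and less: "N < N'"
  shows "real (N' - N) * (t - s) \<le> pruefer \<alpha> t N' - pruefer \<alpha> s N'"
    and "pruefer \<alpha> t N' - pruefer \<alpha> s N'
           \<le> real (N' - N) * (t - s) + 3/2 * (pruefer \<alpha> t N - pruefer \<alpha> s N)"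
proof -
  define d where "d = N' - Suc N"
  have N': "N' = Suc N + d" "N' - N = Suc d"
    using less by (auto simp: d_def)
  have free: "pruefer \<alpha> \<theta> N' = pruefer \<alpha> \<theta> (Suc N) + real d * \<theta>" for \<theta>
    unfolding N'(1) by (rule pruefer_free_evolution) (use gap N' in auto)
  note step = pruefer_step[where \<alpha> = \<alpha> and n = N and s = s and t = t,
      OF small st pruefer_mono[where \<alpha> = \<alpha>, OF small st]]
  show "real (N' - N) * (t - s) \<le> pruefer \<alpha> t N' - pruefer \<alpha> s N'"
    using step(1) unfolding free N'(2) by (simp add: algebra_simps del: pruefer.simps)
  show "pruefer \<alpha> t N' - pruefer \<alpha> s N'
           \<le> real (N' - N) * (t - s) + 3/2 * (pruefer \<alpha> t N - pruefer \<alpha> s N)"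
    using step(2) unfolding free N'(2) by (simp add: algebra_simps del: pruefer.simps)
qed

lemma lacunary_strict_mono:
  fixes N :: "nat \<Rightarrow> nat"
  assumes "0 < N 0" "\<And>i. 9 * N i \<le> N (Suc i)"
  shows "strict_mono N" "0 < N i"
proof -
  show pos: "0 < N i" for i
    by (induction i) (use assms in \<open>auto intro: less_le_trans[OF _ assms(2)]\<close>)
  show "strict_mono N"
    unfolding strict_mono_Suc_iff
  proof
    fix i
    show "N i < N (Suc i)"
      using assms(2)[of i] pos[of i] by linarith
  qed
qed
text \<open>
  By induction \<open>N\<^sub>i\<^sub>+\<^sub>1 - N\<^sub>i + 3/2 * 2 N\<^sub>i = N\<^sub>i\<^sub>+\<^sub>1 + 2 N\<^sub>i \<le> 2 N\<^sub>i\<^sub>+\<^sub>1\<close>: the free rotation in the long gap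
  outweighs the distortion inherited from earlier times.
\<close>
lemma pruefer_lipschitz_lacunary:
  assumes small: "\<And>n. cmod (\<alpha> n) \<le> 1/5"
    and supp: "{n. \<alpha> n \<noteq> 0} \<subseteq> range N"
    and N0: "0 < N 0" and lac: "\<And>i. 9 * N i \<le> N (Suc i)"
    and st: "s \<le> t"
  shows "pruefer \<alpha> t (N i) - pruefer \<alpha> s (N i) \<le> 2 * real (N i) * (t - s)"
proof -
  have zero: "\<alpha> k = 0" if "k \<notin> range N" for k
    using supp that by blast
  have mono: "strict_mono N"
    using N0 lac by (rule lacunary_strict_mono(1))
  show ?thesis
  proof (induction i)
    case 0
    have "pruefer \<alpha> \<theta> (0 + N 0) = pruefer \<alpha> \<theta> 0 + real (N 0) * \<theta>" for \<theta>
    proof (rule pruefer_free_evolution)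
      show "\<alpha> k = 0" if "k < 0 + N 0" for k
        using that strict_mono_less[OF mono, of _ 0] by (intro zero) auto
    qed
    then have "pruefer \<alpha> t (N 0) - pruefer \<alpha> s (N 0) = (1 + real (N 0)) * (t - s)"
      by (simp add: algebra_simps)
    also have "\<dots> \<le> 2 * real (N 0) * (t - s)"
      by (rule mult_right_mono) (use N0 st in auto)
    finally show ?case .
  next
    case (Suc i)
    have "pruefer \<alpha> t (N (Suc i)) - pruefer \<alpha> s (N (Suc i))
        \<le> real (N (Suc i) - N i) * (t - s) + 3/2 * (pruefer \<alpha> t (N i) - pruefer \<alpha> s (N i))"
    proof (rule pruefer_block(2)[OF small st])
      show "\<alpha> k = 0" if "N i < k" "k < N (Suc i)" for k
        using that mono by (intro zero) (auto simp: strict_mono_less)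
    qed (use mono in \<open>simp_all add: strict_mono_less\<close>)
    also have "\<dots> \<le> real (N (Suc i) - N i) * (t - s) + 3/2 * (2 * real (N i) * (t - s))"
      by (intro add_left_mono mult_left_mono Suc) simp
    also have "\<dots> = (real (N (Suc i)) + 2 * real (N i)) * (t - s)"
      using lac[of i] by (simp add: of_nat_diff algebra_simps)
    also have "\<dots> \<le> 2 * real (N (Suc i)) * (t - s)"
      by (rule mult_right_mono) (use lac[of i] st in auto)
    finally show ?case .
  qed
qed


text \<open>
  The step of the nested interval construction.  The length \<open>\<pi> / (3 N\<^sub>i)\<close> of the new interval is
  just enough for the next phase to increase by \<open>8 N\<^sub>i * \<pi> / (3 N\<^sub>i) = 8\<pi>/3\<close> on it, which is what the
  construction needs in order to continue.
\<close>
lemma good_subinterval: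
  assumes small: "\<And>n. cmod (\<alpha> n) \<le> 1/5"
    and supp: "{n. \<alpha> n \<noteq> 0} \<subseteq> range N"
    and N0: "0 < N 0" and lac: "\<And>i. 9 * N i \<le> N (Suc i)"
    and lr: "l \<le> r"
    and large: "8*pi/3 \<le> pruefer \<alpha> r (N i) - pruefer \<alpha> l (N i)"
  obtains l' r' where "l \<le> l'" "l' \<le> r'" "r' \<le> r" "r' - l' \<ge> pi / (3 * real (N i))"
    "\<And>t. t \<in> {l'..r'} \<Longrightarrow> Re (\<alpha> (N i) * cis (pruefer \<alpha> t (N i))) \<le> - cmod (\<alpha> (N i)) / 2"
proof -
  have pos: "2 * real (N i) > 0"
    using lacunary_strict_mono(2)[OF N0 lac] by simp
  have polar: "Re (\<alpha> (N i) * cis x) = cmod (\<alpha> (N i)) * cos (x + Arg (\<alpha> (N i)))" for x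
  proof -
    have "\<alpha> (N i) * cis x = of_real (cmod (\<alpha> (N i))) * cis (x + Arg (\<alpha> (N i)))"
      using rcis_cmod_Arg[of "\<alpha> (N i)"]
      by (metis (no_types) add.commute cis_mult mult.assoc rcis_def)
    then show ?thesis by simp
  qed
  have lip: "0 \<le> pruefer \<alpha> t (N i) - pruefer \<alpha> s (N i)
      \<and> pruefer \<alpha> t (N i) - pruefer \<alpha> s (N i) \<le> 2 * real (N i) * (t - s)" if "s \<le> t" for s t
    using pruefer_mono[where \<alpha> = \<alpha> and n = "N i", OF small that]
      pruefer_lipschitz_lacunary[where \<alpha> = \<alpha> and N = N and i = i, OF small supp N0 lac that]
    by simp
  obtain l' r' where *: "l \<le> l'" "l' \<le> r'" "r' \<le> r" "r' - l' \<ge> 2*pi/3 / (2 * real (N i))"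
      "\<And>t. l' \<le> t \<Longrightarrow> t \<le> r' \<Longrightarrow> cos (pruefer \<alpha> t (N i) + Arg (\<alpha> (N i))) \<le> -1/2"
    using subinterval_of_large_phase[of l r "\<lambda>t. pruefer \<alpha> t (N i)", OF lip lr pos large] by blast
  show thesis
  proof (rule that[OF *(1-3)])
    show "r' - l' \<ge> pi / (3 * real (N i))"
      using *(4) by (simp add: field_simps)
    show "Re (\<alpha> (N i) * cis (pruefer \<alpha> t (N i))) \<le> - cmod (\<alpha> (N i)) / 2" if "t \<in> {l'..r'}" for t
      using mult_left_mono[OF *(5)[of t], of "cmod (\<alpha> (N i))"] that
      unfolding polar by simp
  qed
qed

text \<open>
  The intervals of stage \<open>i\<close> fix the phase at time \<open>N\<^sub>i\<close> up to \<open>\<pi>/3\<close> but leave the next phase free to take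
  every value, so the requirements for all \<open>i\<close> can be met one after the other; compactness
  provides a common point.
\<close>
lemma lacunary_aligned_point:
  assumes small: "\<And>n. cmod (\<alpha> n) \<le> 1/5"
    and supp: "{n. \<alpha> n \<noteq> 0} \<subseteq> range N"
    and N0: "0 < N 0" and lac: "\<And>i. 9 * N i \<le> N (Suc i)"
  obtains \<theta> where
    "\<And>i. Re (\<alpha> (N i) * cis (pruefer \<alpha> \<theta> (N i))) \<le> - cmod (\<alpha> (N i)) / 2"
proof -
  note sub = good_subinterval[where \<alpha> = \<alpha> and N = N, OF small supp N0 lac]
  have zero: "\<alpha> k = 0" if "k \<notin> range N" for k
    using supp that by blast
  note mono = lacunary_strict_mono[where N = N, OF N0 lac]
  define good where "good i J \<longleftrightarrow> fst J \<le> snd J \<and> snd J - fst J \<ge> pi / (3 * real (N i)) \<and>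
      (\<forall>t\<in>{fst J..snd J}. Re (\<alpha> (N i) * cis (pruefer \<alpha> t (N i))) \<le> - cmod (\<alpha> (N i)) / 2)"
    for i and J :: "real \<times> real"
  have "\<exists>J. \<forall>i. good i (J i) \<and> fst (J i) \<le> fst (J (Suc i)) \<and> snd (J (Suc i)) \<le> snd (J i)"
  proof (rule dependent_nat_choice)
    obtain m where m: "N 0 = Suc m"
      using N0 gr0_implies_Suc by blast
    \<comment> \<open>Any starting interval longer than \<open>8\<pi>/3\<close> would do; it may wind more than once around the circle.\<close>
    have "3*pi - 0 \<le> pruefer \<alpha> (3*pi) (N 0) - pruefer \<alpha> 0 (N 0)"
      unfolding m by (rule pruefer_step(1)[OF small _ pruefer_mono[OF small]]) simp_all
    then have large: "8*pi/3 \<le> pruefer \<alpha> (3*pi) (N 0) - pruefer \<alpha> 0 (N 0)"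
      using pi_gt_zero by linarith
    have lr0: "0 \<le> 3*pi" by simp
    obtain l r where "l \<le> r" "r - l \<ge> pi / (3 * real (N 0))"
      "\<And>t. t \<in> {l..r} \<Longrightarrow> Re (\<alpha> (N 0) * cis (pruefer \<alpha> t (N 0))) \<le> - cmod (\<alpha> (N 0)) / 2"
      by (rule sub[OF lr0 large], rule that, assumption+)
    then have "good 0 (l, r)" by (simp add: good_def)
    then show "\<exists>J. good 0 J" ..
  next
    fix J i assume J: "good i J"
    define l r where "l = fst J" and "r = snd J"
    have lr: "l \<le> r" "r - l \<ge> pi / (3 * real (N i))"
      using J by (auto simp: good_def l_def r_def)
    have "8*pi/3 = real (8 * N i) * (pi / (3 * real (N i)))"
      using mono(2)[of i] by (simp add: field_simps)
    also have "\<dots> \<le> real (N (Suc i) - N i) * (r - l)"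
      using lac[of i] lr pi_gt_zero by (intro mult_mono) auto
    also have "\<dots> \<le> pruefer \<alpha> r (N (Suc i)) - pruefer \<alpha> l (N (Suc i))"
    proof (rule pruefer_block(1)[where \<alpha> = \<alpha>, OF small lr(1)])
      show "\<alpha> k = 0" if "N i < k" "k < N (Suc i)" for k
        using that mono by (intro zero) (auto simp: strict_mono_less)
    qed (use mono in \<open>simp_all add: strict_mono_less\<close>)
    finally have large: "8*pi/3 \<le> pruefer \<alpha> r (N (Suc i)) - pruefer \<alpha> l (N (Suc i))" .
    obtain l' r' where "l \<le> l'" "l' \<le> r'" "r' \<le> r" "r' - l' \<ge> pi / (3 * real (N (Suc i)))"
      "\<And>t. t \<in> {l'..r'} \<Longrightarrow>
         Re (\<alpha> (N (Suc i)) * cis (pruefer \<alpha> t (N (Suc i)))) \<le> - cmod (\<alpha> (N (Suc i))) / 2"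
      by (rule sub[OF lr(1) large], rule that, assumption+)
    then have "good (Suc i) (l', r') \<and> fst J \<le> fst (l', r') \<and> snd (l', r') \<le> snd J"
      by (auto simp: good_def l_def r_def)
    then show "\<exists>J'. good (Suc i) J' \<and> fst J \<le> fst J' \<and> snd J' \<le> snd J"
      by blast
  qed
  then obtain J where J: "\<And>i. good i (J i)" "\<And>i. fst (J i) \<le> fst (J (Suc i))"
      "\<And>i. snd (J (Suc i)) \<le> snd (J i)"
    by blast
  have "(\<Inter>i. {fst (J i)..snd (J i)}) \<noteq> {}"
  proof (rule compact_nest)
    show "{fst (J i)..snd (J i)} \<noteq> {}" for i
      using J(1)[of i] by (auto simp: good_def)
    show "{fst (J j)..snd (J j)} \<subseteq> {fst (J i)..snd (J i)}" if "i \<le> j" for i j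
    proof -
      have "fst (J i) \<le> fst (J j)"
        using that by (rule lift_Suc_mono_le[of "\<lambda>i. fst (J i)", OF J(2)])
      moreover have "snd (J j) \<le> snd (J i)"
        using that by (rule lift_Suc_antimono_le[of "\<lambda>i. snd (J i)", OF J(3)])
      ultimately show ?thesis by auto
    qed
  qed auto
  then obtain \<theta> where "\<And>i. \<theta> \<in> {fst (J i)..snd (J i)}" by blast
  then show thesis using that J(1) unfolding good_def by blast
qed

lemma one_plus_sum_le_prod:
  fixes f :: "nat \<Rightarrow> real"
  assumes "\<And>i. f i \<ge> 0"
  shows "1 + (\<Sum>i<n. f i) \<le> (\<Prod>i<n. 1 + f i)"
proof (induction n)
  case (Suc n)
  have "0 \<le> (\<Sum>i<n. f i)" by (simp add: sum_nonneg assms)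
  then have "(1 + (\<Sum>i<n. f i)) * (1 + f n) \<ge> 1 + (\<Sum>i<Suc n. f i)"
    using assms[of n] by (simp add: algebra_simps)
  also have "(1 + (\<Sum>i<n. f i)) * (1 + f n) \<le> (\<Prod>i<n. 1 + f i) * (1 + f n)"
    using Suc assms[of n] by (intro mult_right_mono) auto
  finally show ?case by simp
qed simp

lemma nonneg_not_summable_unbounded:
  fixes f :: "nat \<Rightarrow> real"
  assumes "\<And>i. f i \<ge> 0" "\<not> summable f"
  obtains n where "B \<le> (\<Sum>i<n. f i)"
proof -
  have "\<exists>n. B \<le> (\<Sum>i<n. f i)"
  proof (rule ccontr)
    assume "\<nexists>n. B \<le> (\<Sum>i<n. f i)"
    then have "(\<Sum>i<n. f i) \<le> B" for n by (meson linear)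
    then have "summable f" using assms(1) by (intro summableI_nonneg_bounded)
    with assms(2) show False by simp
  qed
  then show thesis using that by blast
qed

text \<open>
  At an aligned point every factor in the product formula for \<open>\<bar>\<Phi>\<^sub>n\<bar>\<close> exceeds \<open>1\<close> by at least half
  the modulus of the parameter, so the product diverges along with the sum of the moduli.
\<close>
theorem opuc_lacunary_unbounded:
  assumes small: "\<And>n. cmod (\<alpha> n) \<le> 1/5"
    and supp: "{n. \<alpha> n \<noteq> 0} \<subseteq> range N"
    and N0: "0 < N 0" and lac: "\<And>i. 9 * N i \<le> N (Suc i)"
    and diverges: "\<not> summable (\<lambda>i. cmod (\<alpha> (N i)))"
  shows "\<exists>\<theta>\<in>{0..<2*pi}. (SUP n. ereal (cmod (poly (opuc \<alpha> n) (cis \<theta>)))) = \<infinity>"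
proof -
  have zero: "\<alpha> k = 0" if "k \<notin> range N" for k
    using supp that by blast
  note mono = lacunary_strict_mono[where N = N, OF N0 lac]
  obtain \<theta> where \<theta>:
      "\<And>i. Re (\<alpha> (N i) * cis (pruefer \<alpha> \<theta> (N i))) \<le> - cmod (\<alpha> (N i)) / 2"
    using lacunary_aligned_point[where \<alpha> = \<alpha> and N = N, OF small supp N0 lac] by blast
  have less1: "cmod (\<alpha> n) < 1" for n
    using small[of n] by linarith
  have lower: "1 + (\<Sum>i<I. cmod (\<alpha> (N i)) / 2) \<le> cmod (poly (opuc \<alpha> (N I)) (cis \<theta>))" for I
  proof -
    have "1 + (\<Sum>i<I. cmod (\<alpha> (N i)) / 2) \<le> (\<Prod>i<I. 1 + cmod (\<alpha> (N i)) / 2)"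
      by (rule one_plus_sum_le_prod) simp
    also have "\<dots> \<le> (\<Prod>i<I. cmod (1 - \<alpha> (N i) * cis (pruefer \<alpha> \<theta> (N i))))"
    proof (rule prod_mono, safe)
      fix i
      show "1 + cmod (\<alpha> (N i)) / 2 \<le> cmod (1 - \<alpha> (N i) * cis (pruefer \<alpha> \<theta> (N i)))"
        using \<theta>[of i] complex_Re_le_cmod[of "1 - \<alpha> (N i) * cis (pruefer \<alpha> \<theta> (N i))"] by simp
    qed simp
    also have "\<dots> = (\<Prod>k\<in>N ` {..<I}. cmod (1 - \<alpha> k * cis (pruefer \<alpha> \<theta> k)))"
      using strict_mono_imp_inj_on[OF mono(1)] by (subst prod.reindex) (auto intro: inj_on_subset)
    also have "\<dots> = (\<Prod>k<N I. cmod (1 - \<alpha> k * cis (pruefer \<alpha> \<theta> k)))"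
    proof (rule prod.mono_neutral_left)
      show "N ` {..<I} \<subseteq> {..<N I}"
        using mono(1) by (auto simp: strict_mono_less)
      show "\<forall>k\<in>{..<N I} - N ` {..<I}. cmod (1 - \<alpha> k * cis (pruefer \<alpha> \<theta> k)) = 1"
      proof
        fix k assume "k \<in> {..<N I} - N ` {..<I}"
        then have "k \<notin> range N"
          using mono(1) by (auto simp: strict_mono_less)
        then show "cmod (1 - \<alpha> k * cis (pruefer \<alpha> \<theta> k)) = 1"
          by (simp add: zero)
      qed
    qed simp
    also have "\<dots> = cmod (poly (opuc \<alpha> (N I)) (cis \<theta>))"
      by (rule norm_opuc_eq_prod[symmetric]) (rule less1)
    finally show ?thesis .
  qed
  have sup: "(SUP n. ereal (cmod (poly (opuc \<alpha> n) (cis \<theta>)))) = \<infinity>"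
  proof (rule SUP_PInfty)
    fix m
    obtain I where I: "2 * real m \<le> (\<Sum>i<I. cmod (\<alpha> (N i)))"
      using nonneg_not_summable_unbounded[of "\<lambda>i. cmod (\<alpha> (N i))"] diverges by auto
    have "real m \<le> cmod (poly (opuc \<alpha> (N I)) (cis \<theta>))"
      using I lower[of I] by (simp add: sum_divide_distrib[symmetric])
    then show "\<exists>n\<in>UNIV. ereal (real m) \<le> ereal (cmod (poly (opuc \<alpha> n) (cis \<theta>)))"
      by auto
  qed
  have "cis (Arg2pi (cis \<theta>)) = cis \<theta>"
    using Arg2pi_eq[of "cis \<theta>"] by (simp add: cis_conv_exp)
  then show ?thesis
    using sup Arg2pi_ge_0[of "cis \<theta>"] Arg2pi_lt_2pi[of "cis \<theta>"]
    by (intro bexI[of _ "Arg2pi (cis \<theta>)"]) auto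
qed

section \<open>Independent rotationally symmetric variables\<close>

text \<open>
  A rotation by \<open>t' \<in> [0, 2\<pi>)\<close> shifts \<open>[0, 2\<pi>)\<close> to \<open>[t', 2\<pi> + t')\<close>; translating the part beyond \<open>2\<pi>\<close> back by
  a full period restores the original interval.
\<close>
lemma uniform_arc_rotation:
  "distr (uniform_measure lborel {0..<2*pi}) borel (\<lambda>s. cis (s + t))
     = distr (uniform_measure lborel {0..<2*pi}) borel cis"
proof -
  define t' where "t' = Arg2pi (cis t)"
  have t': "0 \<le> t'" "t' < 2*pi" and cis_t: "cis t = cis t'"
    using Arg2pi_eq[of "cis t"] Arg2pi_ge_0[of "cis t"] Arg2pi_lt_2pi[of "cis t"]
    by (simp_all add: t'_def cis_conv_exp)
  have cis_meas[measurable]: "cis \<in> borel_measurable borel"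
    by (intro borel_measurable_continuous_onI) (simp add: cis_conv_exp continuous_intros)
  have "emeasure lborel ({0..<2*pi} \<inter> {s. cis (s + t) \<in> A})
      = emeasure lborel ({0..<2*pi} \<inter> {s. cis s \<in> A})" if A[measurable]: "A \<in> sets borel" for A
  proof -
    have shift: "emeasure lborel {s. P (s + c)} = emeasure lborel {s. P s}"
      if [measurable]: "Measurable.pred borel P" for P and c :: real
    proof -
      have "emeasure lborel {s. P s} = emeasure (distr lborel borel ((+) c)) {s. P s}"
        by (simp add: lborel_distr_plus)
      also have "\<dots> = emeasure lborel {s. P (s + c)}"
        by (subst emeasure_distr) (auto simp: vimage_def add.commute)
      finally show ?thesis by simp
    qed
    have split: "emeasure lborel {s. P s}
        = emeasure lborel {s. P s \<and> s < c} + emeasure lborel {s. P s \<and> c \<le> s}"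
      if [measurable]: "Measurable.pred borel P" for P and c :: real
      by (subst plus_emeasure) (auto intro!: arg_cong[where f = "emeasure lborel"])
    have "{0..<2*pi} \<inter> {s. cis (s + t) \<in> A} = {s. t' \<le> s + t' \<and> s + t' < 2*pi + t' \<and> cis (s + t') \<in> A}"
      by (auto simp: cis_mult[symmetric] cis_t)
    also have "emeasure lborel \<dots> = emeasure lborel {s. t' \<le> s \<and> s < 2*pi + t' \<and> cis s \<in> A}"
      by (rule shift) measurable
    also have "\<dots> = emeasure lborel {s. (t' \<le> s \<and> s < 2*pi + t' \<and> cis s \<in> A) \<and> s < 2*pi}
        + emeasure lborel {s. (t' \<le> s \<and> s < 2*pi + t' \<and> cis s \<in> A) \<and> 2*pi \<le> s}"
      by (rule split) measurable
    also have "{s. (t' \<le> s \<and> s < 2*pi + t' \<and> cis s \<in> A) \<and> s < 2*pi}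
        = {s. (0 \<le> s \<and> s < 2*pi \<and> cis s \<in> A) \<and> t' \<le> s}"
      using t' by auto
    also have "emeasure lborel {s. (t' \<le> s \<and> s < 2*pi + t' \<and> cis s \<in> A) \<and> 2*pi \<le> s}
        = emeasure lborel {s. (t' \<le> s + 2*pi \<and> s + 2*pi < 2*pi + t' \<and> cis (s + 2*pi) \<in> A) \<and> 2*pi \<le> s + 2*pi}"
      by (rule shift[symmetric]) measurable
    also have "{s. (t' \<le> s + 2*pi \<and> s + 2*pi < 2*pi + t' \<and> cis (s + 2*pi) \<in> A) \<and> 2*pi \<le> s + 2*pi}
        = {s. (0 \<le> s \<and> s < 2*pi \<and> cis s \<in> A) \<and> s < t'}"
      using t' by (auto simp: cis_mult[symmetric])
    also have "emeasure lborel {s. (0 \<le> s \<and> s < 2*pi \<and> cis s \<in> A) \<and> t' \<le> s}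
        + emeasure lborel {s. (0 \<le> s \<and> s < 2*pi \<and> cis s \<in> A) \<and> s < t'}
        = emeasure lborel {s. 0 \<le> s \<and> s < 2*pi \<and> cis s \<in> A}"
      by (subst add.commute, rule split[symmetric]) measurable
    also have "{s. 0 \<le> s \<and> s < 2*pi \<and> cis s \<in> A} = {0..<2*pi} \<inter> {s. cis s \<in> A}"
      by auto
    finally show ?thesis .
  qed
  then show ?thesis
    by (intro measure_eqI) (auto simp: emeasure_distr vimage_def)
qed

lemma rotationally_symmetric_half_cis:
  fixes X :: "'a \<Rightarrow> real"
  assumes [measurable]: "X \<in> borel_measurable M"
    and dist: "distr M borel X = uniform_measure lborel {0..<2*pi}"
  shows "rotationally_symmetric M (\<lambda>x. cis (X x) / 2)"
  unfolding rotationally_symmetric_def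
proof (intro conjI allI)
  have cis_meas[measurable]: "cis \<in> borel_measurable borel"
    by (intro borel_measurable_continuous_onI) (simp add: cis_conv_exp continuous_intros)
  show "(\<lambda>x. cis (X x) / 2) \<in> borel_measurable M"
    by measurable
  fix t :: real
  let ?U = "uniform_measure lborel {0..<2*pi}"
  have "distr M borel (\<lambda>x. exp (\<i> * complex_of_real t) * (cis (X x) / 2))
      = distr (distr (distr M borel X) borel (\<lambda>s. cis (s + t))) borel (\<lambda>z. z / 2)"
    by (simp add: distr_distr comp_def cis_conv_exp exp_add algebra_simps)
  also have "\<dots> = distr (distr (distr M borel X) borel cis) borel (\<lambda>z. z / 2)"
    unfolding dist uniform_arc_rotation ..
  also have "\<dots> = distr M borel (\<lambda>x. cis (X x) / 2)"
    by (simp add: distr_distr comp_def)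
  finally show "distr M borel (\<lambda>x. exp (\<i> * complex_of_real t) * (cis (X x) / 2))
      = distr M borel (\<lambda>x. cis (X x) / 2)" .
qed

text \<open>
  The coordinates of an infinite product of uniform distributions on \<open>[0, 2\<pi>)\<close>, embedded in the
  complex plane, serve as independent random angles.  Taking real parts first makes the modulus
  equal to \<open>1/2\<close> at every point of the sample space, not just almost surely.
\<close>
lemma exists_independent_rotationally_symmetric:
  "\<exists>(M :: (nat \<Rightarrow> complex) measure) (\<omega> :: nat \<Rightarrow> (nat \<Rightarrow> complex) \<Rightarrow> complex). prob_space M \<and>
     prob_space.indep_vars M (\<lambda>_. borel) \<omega> UNIV \<and>
     (\<forall>n. rotationally_symmetric M (\<omega> n)) \<and> (\<forall>n x. cmod (\<omega> n x) = 1/2)"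
proof -
  define U where "U = uniform_measure lborel {0..<2*pi}"
  define M where "M = PiM (UNIV :: nat set) (\<lambda>_. distr U borel complex_of_real)"
  have cis_meas[measurable]: "cis \<in> borel_measurable borel"
    by (intro borel_measurable_continuous_onI) (simp add: cis_conv_exp continuous_intros)
  have sets_U[measurable_cong]: "sets U = sets borel"
    by (simp add: U_def)
  interpret U: prob_space U
    unfolding U_def by (rule prob_space_uniform_measure) (auto simp: emeasure_lborel_Ico)
  interpret D: prob_space "distr U borel complex_of_real"
    by (rule U.prob_space_distr) measurable
  interpret product_prob_space "\<lambda>_::nat. distr U borel complex_of_real" UNIV
    by unfold_locales
  interpret M: prob_space M
    unfolding M_def by (rule prob_space_PiM) unfold_locales
  have comp: "(\<lambda>x. x n) \<in> borel_measurable M" for n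
    unfolding M_def by measurable
  have component: "distr M borel (\<lambda>x. x n) = distr U borel complex_of_real" for n
    unfolding M_def using PiM_component[of n] by (simp cong: distr_cong)
  then have "distr (distr M borel (\<lambda>x. x n)) borel Re = U" for n
    by (simp add: distr_distr comp_def distr_id2 sets_U)
  then have law: "distr M borel (\<lambda>x. Re (x n)) = uniform_measure lborel {0..<2*pi}" for n
    using distr_distr[of Re borel borel "\<lambda>x. x n" M] comp[of n] by (simp add: comp_def U_def)
  have "M.indep_vars (\<lambda>_. borel) (\<lambda>n x. x n) UNIV"
  proof (subst M.indep_vars_iff_distr_eq_PiM)
    have "distr M (PiM UNIV (\<lambda>_. borel)) (\<lambda>x. \<lambda>i\<in>UNIV. x i) = M"
    proof -
      have "sets (PiM UNIV (\<lambda>_::nat. borel :: complex measure)) = sets M"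
        unfolding M_def by (rule sets_PiM_cong) auto
      then show ?thesis by (simp add: distr_id2 restrict_def)
    qed
    then show "distr M (PiM UNIV (\<lambda>_. borel)) (\<lambda>x. \<lambda>i\<in>UNIV. x i)
        = PiM UNIV (\<lambda>i. distr M borel (\<lambda>x. x i))"
      unfolding component unfolding M_def .
  qed (use comp in auto)
  then have "M.indep_vars (\<lambda>_. borel) (\<lambda>n. (\<lambda>z. cis (Re z) / 2) \<circ> (\<lambda>x. x n)) UNIV"
    by (rule M.indep_vars_compose) measurable
  then have "M.indep_vars (\<lambda>_. borel) (\<lambda>n x. cis (Re (x n)) / 2) UNIV"
    by (simp add: comp_def)
  moreover have "rotationally_symmetric M (\<lambda>x. cis (Re (x n)) / 2)" for n
    using comp[of n] law[of n] by (intro rotationally_symmetric_half_cis) auto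
  ultimately show ?thesis
    using M.prob_space_axioms
    by (intro exI[of _ M] exI[of _ "\<lambda>(n::nat) x. cis (Re (x n)) / 2"]) (auto simp: norm_divide)
qed

section \<open>Blocks of coefficients and their tails\<close>

text \<open>
  For increasing \<open>K\<close> this equals \<open>K\<^sub>j\<^sub>+\<^sub>1\<close> on the block \<open>K\<^sub>j \<le> i < K\<^sub>j\<^sub>+\<^sub>1\<close>.  Being constant on blocks it has a
  divergent series of reciprocals, while \<open>i < next_scale K i\<close> makes the reciprocal squares summable.
\<close>
definition next_scale :: "(nat \<Rightarrow> nat) \<Rightarrow> nat \<Rightarrow> nat" where
  "next_scale K i = K (LEAST j. i < K j)"

lemma less_next_scale:
  assumes "strict_mono K"
  shows "i < next_scale K i"
proof -
  have "i < K (Suc i)"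
    using strict_mono_imp_increasing[OF assms, of "Suc i"] by simp
  then show ?thesis unfolding next_scale_def by (rule LeastI)
qed

lemma next_scale_le:
  assumes "strict_mono K" "i < K j"
  shows "next_scale K i \<le> K j"
  unfolding next_scale_def
  using assms by (simp add: strict_mono_less_eq Least_le)

lemma next_scale_ge:
  assumes "strict_mono K" "K j \<le> i"
  shows "K (Suc j) \<le> next_scale K i"
proof -
  have "K j < K (LEAST j. i < K j)"
    using less_next_scale[OF assms(1), of i] assms(2) by (simp add: next_scale_def)
  then show ?thesis
    using assms(1) by (simp add: next_scale_def strict_mono_less strict_mono_less_eq)
qed

text \<open>
  As \<open>K\<close> at least doubles, the block from \<open>K\<^sub>j\<close> to \<open>K\<^sub>j\<^sub>+\<^sub>1\<close> has at least \<open>K\<^sub>j\<^sub>+\<^sub>1 / 2\<close> terms, all equal to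
  \<open>1 / K\<^sub>j\<^sub>+\<^sub>1\<close>.
\<close>
lemma sum_inverse_next_scale:
  assumes K: "strict_mono K" and dbl: "\<And>j. 2 * K j \<le> K (Suc j)"
  shows "real j / 2 \<le> (\<Sum>i<K j. 1 / real (next_scale K i))"
proof (induction j)
  case (Suc j)
  have less: "K j < K (Suc j)"
    using K by (simp add: strict_mono_less)
  have pos: "0 < real (K (Suc j))"
    using less by simp
  have "1/2 \<le> real (K (Suc j) - K j) * (1 / real (K (Suc j)))"
    using dbl[of j] less pos by (simp add: field_simps of_nat_diff)
  also have "\<dots> = (\<Sum>i\<in>{K j..<K (Suc j)}. 1 / real (K (Suc j)))"
    by simp
  also have "\<dots> \<le> (\<Sum>i\<in>{K j..<K (Suc j)}. 1 / real (next_scale K i))"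
  proof (rule sum_mono)
    fix i assume "i \<in> {K j..<K (Suc j)}"
    then have "next_scale K i \<le> K (Suc j)" "0 < next_scale K i"
      using next_scale_le[OF K, of i "Suc j"] less_next_scale[OF K, of i] by auto
    then show "1 / real (K (Suc j)) \<le> 1 / real (next_scale K i)"
      by (simp add: frac_le)
  qed
  finally have "real (Suc j) / 2 \<le> (\<Sum>i<K j. 1 / real (next_scale K i))
      + (\<Sum>i\<in>{K j..<K (Suc j)}. 1 / real (next_scale K i))"
    using Suc by (simp add: add_divide_distrib)
  also have "\<dots> = (\<Sum>i<K (Suc j). 1 / real (next_scale K i))"
    using sum.atLeastLessThan_concat[of 0 "K j" "K (Suc j)" "\<lambda>i. 1 / real (next_scale K i)"] less
    by (simp add: atLeast0LessThan)
  finally show ?case .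
qed (simp add: sum_nonneg)

lemma not_summable_inverse_next_scale:
  assumes K: "strict_mono K" and dbl: "\<And>j. 2 * K j \<le> K (Suc j)" and c: "c > 0"
  shows "\<not> summable (\<lambda>i. c / real (next_scale K i))"
proof
  assume "summable (\<lambda>i. c / real (next_scale K i))"
  then have "summable (\<lambda>i. inverse c * (c / real (next_scale K i)))"
    by (rule summable_mult)
  then have s: "summable (\<lambda>i. 1 / real (next_scale K i))"
    using c by (simp add: field_simps)
  obtain j :: nat where j: "2 * (\<Sum>i. 1 / real (next_scale K i)) < real j"
    using reals_Archimedean2 by blast
  have "real j / 2 \<le> (\<Sum>i<K j. 1 / real (next_scale K i))"
    using sum_inverse_next_scale[OF K dbl] .
  also have "\<dots> \<le> (\<Sum>i. 1 / real (next_scale K i))"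
    using s by (rule sum_le_suminf) auto
  finally show False using j by simp
qed

text \<open>
  The at most \<open>\<kappa>\<close> indices below \<open>\<kappa>\<close> contribute at most \<open>1 / \<kappa>\<^sup>2\<close> each, and the remaining terms are
  dominated by the telescoping series of \<open>1 / (i (i + 1))\<close>.  The majorant \<open>g\<close> in the proof combines
  both regimes.
\<close>
lemma sum_inverse_squares_le:
  fixes d :: "nat \<Rightarrow> nat"
  assumes "finite I" and "\<And>i. i \<in> I \<Longrightarrow> i < d i" and "\<And>i. i \<in> I \<Longrightarrow> \<kappa> \<le> d i" and "0 < \<kappa>"
  shows "(\<Sum>i\<in>I. 1 / (real (d i))\<^sup>2) \<le> 2 / real \<kappa>"
proof -
  define g where "g i = (if i < \<kappa> then 1 / (real \<kappa>)\<^sup>2 else 1 / real i - 1 / real (Suc i))" for i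
  have g0: "0 \<le> g i" for i
    using assms(4) by (auto simp: g_def frac_le)
  have le: "1 / (real (d i))\<^sup>2 \<le> g i" if "i \<in> I" for i
  proof (cases "i < \<kappa>")
    case True
    then show ?thesis
      using assms(3)[OF that] assms(4) by (auto simp: g_def intro!: frac_le power_mono)
  next
    case False
    then have i: "0 < real i" using assms(4) by simp
    have "real i * (real i + 1) \<le> (real (d i))\<^sup>2"
      unfolding power2_eq_square using assms(2)[OF that] by (intro mult_mono) auto
    then have "1 / (real (d i))\<^sup>2 \<le> 1 / (real i * (real i + 1))"
      using i assms(2)[OF that] by (intro divide_left_mono mult_pos_pos) auto
    also have "\<dots> = 1 / real i - 1 / real (Suc i)"
      using i by (simp add: field_simps)
    finally show ?thesis using False by (simp add: g_def)
  qed
  obtain m where m: "\<And>i. i \<in> I \<Longrightarrow> i < m"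
    using finite_nat_bounded[OF assms(1)] by blast
  have total: "(\<Sum>i<\<kappa> + n. g i) = 2 / real \<kappa> - 1 / real (\<kappa> + n)" for n
  proof (induction n)
    case 0
    show ?case using assms(4) by (simp add: g_def power2_eq_square)
  qed (simp add: g_def)
  have "(\<Sum>i\<in>I. 1 / (real (d i))\<^sup>2) \<le> (\<Sum>i\<in>I. g i)"
    by (rule sum_mono) (rule le)
  also have "\<dots> \<le> (\<Sum>i<\<kappa> + m. g i)"
    by (rule sum_mono2) (use m g0 in \<open>auto intro: trans_less_add2\<close>)
  also have "\<dots> \<le> 2 / real \<kappa>"
    unfolding total by simp
  finally show ?thesis .
qed

text \<open>
  Comparison with the derivative of \<open>2 sqrt (ln x)\<close>, in the form of a telescoping sum.
\<close>
lemma sum_inverse_times_sqrt_ln_le: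
  assumes "1 \<le> p"
  shows "(\<Sum>n\<in>{p<..q}. 1 / (real n * sqrt (ln (real n)))) \<le> 2 * sqrt (ln (real q))"
proof (cases "p \<le> q")
  case False
  then show ?thesis by (cases "q = 0") auto
next
  case True
  then show ?thesis
  proof (induction q rule: dec_induct)
    case base
    show ?case using assms by simp
  next
    case (step q)
    define A B where "A = sqrt (ln (real (Suc q)))" and "B = sqrt (ln (real q))"
    have q: "1 \<le> q" using step assms by simp
    have A: "0 < A" and B: "0 \<le> B" "B \<le> A"
      using q by (auto simp: A_def B_def)
    have "ln (real q / real (Suc q)) \<le> real q / real (Suc q) - 1"
      using q by (intro ln_le_minus_one) simp
    then have "1 / real (Suc q) \<le> ln (real (Suc q)) - ln (real q)"
      using q by (simp add: ln_div field_simps)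
    also have "\<dots> = (A - B) * (A + B)"
      using q by (simp add: A_def B_def algebra_simps)
    also have "\<dots> \<le> (A - B) * (2 * A)"
      using B by (intro mult_left_mono) auto
    finally have "1 / real (Suc q) / A \<le> (A - B) * (2 * A) / A"
      using A by (intro divide_right_mono) auto
    also have "(A - B) * (2 * A) / A = 2 * A - 2 * B"
      using A by (simp add: field_simps)
    finally have "1 / (real (Suc q) * A) \<le> 2 * A - 2 * B"
      by simp
    moreover have "{p<..Suc q} = insert (Suc q) {p<..q}"
      using step by auto
    ultimately show ?case
      using step.IH unfolding A_def B_def by simp
  qed
qed

lemma summable_on_geometric_blocks:
  fixes f :: "nat \<Rightarrow> real"
  assumes f0: "\<And>n. 0 \<le> f n" and M: "strict_mono M" "M 0 = 1"
    and block: "\<And>j. (\<Sum>n\<in>{M j<..M (Suc j)}. f n) \<le> E * (1/2) ^ j"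
  shows "f summable_on {2..}"
proof (rule nonneg_bdd_above_summable_on)
  have partial: "(\<Sum>n\<in>{1<..M J}. f n) \<le> E * (2 - 2 * (1/2) ^ J)" for J
  proof (induction J)
    case (Suc J)
    have "M 0 \<le> M J" "M J < M (Suc J)"
      using M(1) by (auto intro: monoD[OF strict_mono_mono] simp: strict_mono_less)
    then have "{1<..M (Suc J)} = {1<..M J} \<union> {M J<..M (Suc J)}"
      using M by auto
    then have "(\<Sum>n\<in>{1<..M (Suc J)}. f n) = (\<Sum>n\<in>{1<..M J}. f n) + (\<Sum>n\<in>{M J<..M (Suc J)}. f n)"
      by (simp add: sum.union_disjoint)
    then show ?case using Suc block[of J] by (simp add: algebra_simps)
  qed (simp add: M)
  have "0 \<le> (\<Sum>n\<in>{M 0<..M (Suc 0)}. f n)"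
    by (simp add: sum_nonneg f0)
  then have E: "0 \<le> E" using block[of 0] by simp
  show "bdd_above (sum f ` {F. F \<subseteq> {2..} \<and> finite F})"
  proof (rule bdd_aboveI2)
    fix F assume "F \<in> {F. F \<subseteq> {2::nat..} \<and> finite F}"
    then have F: "F \<subseteq> {2..}" "finite F" by auto
    obtain J where J: "\<And>n. n \<in> F \<Longrightarrow> n < J"
      using finite_nat_bounded[OF F(2)] by blast
    have "F \<subseteq> {1<..M J}"
      using F(1) J strict_mono_imp_increasing[OF M(1), of J] by (force intro: less_imp_le less_le_trans)
    then have "sum f F \<le> (\<Sum>n\<in>{1<..M J}. f n)"
      by (intro sum_mono2) (auto simp: f0)
    also have "\<dots> \<le> E * (2 - 2 * (1/2) ^ J)"
      by (rule partial)
    also have "\<dots> \<le> E * 2"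
      using E by (intro mult_left_mono) auto
    finally show "sum f F \<le> E * 2" .
  qed
qed (use f0 in auto)

text \<open>
  The exponents \<open>K\<^sub>j - 1\<close> rather than \<open>K\<^sub>j\<close> appear because \<open>n > 16\<close> to the power \<open>K\<^sub>j - 1\<close> already forces all
  exponents \<open>i\<close> with \<open>16\<^sup>i \<ge> n\<close> to be at least \<open>K\<^sub>j\<close>; with \<open>K\<^sub>0 = 1\<close> the blocks start right after \<open>n = 1\<close>.
\<close>
lemma exists_sparse_scales:
  fixes \<nu> :: "nat \<Rightarrow> real"
  assumes "filterlim \<nu> at_top sequentially"
  obtains K :: "nat \<Rightarrow> nat" where "K 0 = 1" "strict_mono K" "\<And>j. 2 * K j \<le> K (Suc j)"
    "\<And>j. \<nu> 1 * 2 ^ j \<le> \<nu> (16 ^ (K j - 1))"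
proof -
  have "\<exists>K. \<forall>j. (0 < K j \<and> (j = 0 \<longrightarrow> K j = 1) \<and> \<nu> 1 * 2 ^ j \<le> \<nu> (16 ^ (K j - 1))) \<and> 2 * K j \<le> K (Suc j)"
  proof (rule dependent_nat_choice)
    show "\<exists>k. 0 < k \<and> (0 = (0::nat) \<longrightarrow> k = 1) \<and> \<nu> 1 * 2 ^ 0 \<le> \<nu> (16 ^ (k - 1))"
      by (intro exI[of _ 1]) simp
  next
    fix k j :: nat
    assume k: "0 < k \<and> (j = 0 \<longrightarrow> k = 1) \<and> \<nu> 1 * 2 ^ j \<le> \<nu> (16 ^ (k - 1))"
    obtain n0 where n0: "\<And>n. n0 \<le> n \<Longrightarrow> \<nu> 1 * 2 ^ Suc j \<le> \<nu> n"
      using assms unfolding filterlim_at_top eventually_sequentially by blast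
    have "n0 < 2 ^ n0"
      by (rule less_exp)
    also have "(2::nat) ^ n0 \<le> 16 ^ n0"
      by (rule power_mono) auto
    also have "(16::nat) ^ n0 \<le> 16 ^ (2 * k + n0 - 1)"
      using k by (intro power_increasing) auto
    finally have "n0 \<le> 16 ^ (2 * k + n0 - 1)" by simp
    then show "\<exists>y. (0 < y \<and> (Suc j = 0 \<longrightarrow> y = 1) \<and> \<nu> 1 * 2 ^ Suc j \<le> \<nu> (16 ^ (y - 1))) \<and> 2 * k \<le> y"
      using k n0 by (intro exI[of _ "2 * k + n0"]) auto
  qed
  then obtain K where K: "\<And>j. 0 < K j" "K 0 = 1" "\<And>j. \<nu> 1 * 2 ^ j \<le> \<nu> (16 ^ (K j - 1))"
      "\<And>j. 2 * K j \<le> K (Suc j)"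
    by blast
  have "strict_mono K"
    unfolding strict_mono_Suc_iff
  proof
    show "K j < K (Suc j)" for j
      using K(1)[of j] K(4)[of j] by linarith
  qed
  then show thesis using that K by blast
qed

text \<open>
  The numerator \<open>2\<close> compensates for random factors of modulus \<open>1/2\<close>: the Verblunsky parameter at
  \<open>16\<^sup>i\<close> then has modulus \<open>1 / (5 d\<^sub>i)\<close>, which is at most \<open>1/5\<close> for \<open>d\<^sub>i \<ge> 1\<close>.
\<close>
definition lacunary_coeff :: "(nat \<Rightarrow> nat) \<Rightarrow> nat \<Rightarrow> real" where
  "lacunary_coeff d n =
     (if n \<in> range (\<lambda>i. 16 ^ i) then 2 / (5 * real (d (the_inv (\<lambda>i. 16 ^ i) n))) else 0)"

lemma lacunary_coeff_power: "lacunary_coeff d (16 ^ i) = 2 / (5 * real (d i))"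
proof -
  have "the_inv (\<lambda>i. 16 ^ i) (16 ^ i :: nat) = i"
    by (rule the_inv_f_f) (simp add: inj_on_def)
  then show ?thesis by (simp add: lacunary_coeff_def)
qed

lemma lacunary_coeff_bounds:
  assumes "\<And>i. i < d i"
  shows "0 \<le> lacunary_coeff d n" "lacunary_coeff d n \<le> 2/5"
proof -
  have "2 / (5 * real (d i)) \<le> 2/5" for i
    using assms[of i] by (simp add: field_simps)
  then show "0 \<le> lacunary_coeff d n" "lacunary_coeff d n \<le> 2/5"
    unfolding lacunary_coeff_def by auto
qed

lemma sum_lacunary_coeff_squares_le:
  assumes d: "\<And>i. i < d i" and F: "finite F"
    and \<kappa>: "\<And>i. 16 ^ i \<in> F \<Longrightarrow> \<kappa> \<le> d i" "0 < \<kappa>"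
  shows "(\<Sum>n\<in>F. (lacunary_coeff d n)\<^sup>2) \<le> 8 / (25 * real \<kappa>)"
proof -
  define I where "I = (\<lambda>i. 16 ^ i :: nat) -` F"
  have inj: "inj_on (\<lambda>i. 16 ^ i :: nat) A" for A
    by (simp add: inj_on_def)
  have I: "finite I"
    unfolding I_def by (rule finite_vimageI[OF F inj])
  have "(\<Sum>n\<in>F. (lacunary_coeff d n)\<^sup>2) = (\<Sum>n\<in>(\<lambda>i. 16 ^ i) ` I. (lacunary_coeff d n)\<^sup>2)"
    by (rule sum.mono_neutral_right) (use F in \<open>auto simp: I_def lacunary_coeff_def\<close>)
  also have "\<dots> = (\<Sum>i\<in>I. 4/25 * (1 / (real (d i))\<^sup>2))"
    by (subst sum.reindex[OF inj]) (simp add: lacunary_coeff_power power_divide power_mult_distrib)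
  also have "\<dots> = 4/25 * (\<Sum>i\<in>I. 1 / (real (d i))\<^sup>2)"
    by (rule sum_distrib_left[symmetric])
  also have "\<dots> \<le> 4/25 * (2 / real \<kappa>)"
    by (intro mult_left_mono sum_inverse_squares_le I d) (use \<kappa> in \<open>auto simp: I_def\<close>)
  finally show ?thesis by (simp add: field_simps)
qed

lemma summable_lacunary_coeff_squares:
  assumes d: "\<And>i. i < d i"
  shows "(\<lambda>n. (lacunary_coeff d n)\<^sup>2) summable_on A"
proof (rule nonneg_bdd_above_summable_on)
  show "bdd_above (sum (\<lambda>n. (lacunary_coeff d n)\<^sup>2) ` {F. F \<subseteq> A \<and> finite F})"
  proof (rule bdd_aboveI2)
    fix F assume "F \<in> {F. F \<subseteq> A \<and> finite F}"
    moreover have "1 \<le> d i" for i using d[of i] by simp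
    ultimately show "(\<Sum>n\<in>F. (lacunary_coeff d n)\<^sup>2) \<le> 8 / (25 * real 1)"
      by (intro sum_lacunary_coeff_squares_le d) auto
  qed
qed simp

lemma tail_lacunary_coeff_le:
  assumes d: "\<And>i. i < d i" and "\<And>i. n \<le> 16 ^ i \<Longrightarrow> \<kappa> \<le> d i" "0 < \<kappa>"
  shows "tail_sq_sum (lacunary_coeff d) n \<le> 8 / (25 * real \<kappa>)"
  unfolding tail_sq_sum_def
  by (rule infsum_le_finite_sums[OF summable_lacunary_coeff_squares[OF d]])
     (use assms in \<open>auto intro!: sum_lacunary_coeff_squares_le\<close>)

text \<open>
  On the block \<open>p < n \<le> q\<close> with \<open>q = 16\<close> to the power \<open>K\<^sub>j\<^sub>+\<^sub>1 - 1\<close> the factor \<open>sqrt R\<^sub>n\<close>, of order \<open>1 / sqrt K\<^sub>j\<^sub>+\<^sub>1\<close>,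
  cancels the growth \<open>sqrt (ln q)\<close> of the weights, so that the smallness of \<open>1 / \<nu> p\<close> is what makes
  the blocks summable.
\<close>
lemma weighted_tail_summable:
  fixes \<nu> :: "nat \<Rightarrow> real"
  assumes pos: "\<And>n. \<nu> n > 0" and "mono \<nu>"
    and K: "K 0 = 1" "strict_mono K" "\<And>j. \<nu> 1 * 2 ^ j \<le> \<nu> (16 ^ (K j - 1))"
  defines "a \<equiv> lacunary_coeff (next_scale K)"
  shows "(\<lambda>n. sqrt (tail_sq_sum a n) / (\<nu> n * real n * sqrt (ln (real n)))) summable_on {2..}"
proof (rule summable_on_geometric_blocks[where M = "\<lambda>j. 16 ^ (K j - 1)"
      and E = "2 * sqrt (8/25 * ln 16) / \<nu> 1"])
  have tail0: "0 \<le> tail_sq_sum a n" for n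
    unfolding tail_sq_sum_def by (rule infsum_nonneg) simp
  show "0 \<le> sqrt (tail_sq_sum a n) / (\<nu> n * real n * sqrt (ln (real n)))" for n
    using tail0[of n] pos[of n] by (cases "n = 0") auto
  have K1: "1 \<le> K j" for j
    using K(1,2) strict_mono_less_eq[of K 0 j] by simp
  show "strict_mono (\<lambda>j. 16 ^ (K j - 1) :: nat)"
  proof (rule strict_monoI)
    fix i j :: nat assume "i < j"
    then have "K i - 1 < K j - 1"
      using K(2) K1[of i] by (simp add: strict_mono_less diff_less_mono)
    then show "(16::nat) ^ (K i - 1) < 16 ^ (K j - 1)"
      by simp
  qed
  show "(16::nat) ^ (K 0 - 1) = 1"
    by (simp add: K)
  fix j
  define p q where "p = (16::nat) ^ (K j - 1)" and "q = (16::nat) ^ (K (Suc j) - 1)"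
  have \<nu>p: "\<nu> 1 * 2 ^ j \<le> \<nu> p"
    using K(3) by (simp add: p_def)
  have Kpos: "0 < real (K (Suc j))"
    using K1[of "Suc j"] by simp
  have tail: "tail_sq_sum a n \<le> 8 / (25 * real (K (Suc j)))" if "p < n" for n
    unfolding a_def
  proof (rule tail_lacunary_coeff_le)
    show "i < next_scale K i" for i
      by (rule less_next_scale) fact
    show "K (Suc j) \<le> next_scale K i" if "n \<le> 16 ^ i" for i
    proof (rule next_scale_ge[OF K(2)])
      have "(16::nat) ^ (K j - 1) < 16 ^ i"
        using \<open>p < n\<close> that unfolding p_def by linarith
      then have "K j - 1 < i" by simp
      then show "K j \<le> i" by simp
    qed
  qed (use K1[of "Suc j"] in simp)
  have "(\<Sum>n\<in>{p<..q}. sqrt (tail_sq_sum a n) / (\<nu> n * real n * sqrt (ln (real n))))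
      \<le> (\<Sum>n\<in>{p<..q}. sqrt (8 / (25 * real (K (Suc j)))) / \<nu> p * (1 / (real n * sqrt (ln (real n)))))"
  proof (rule sum_mono)
    fix n assume n: "n \<in> {p<..q}"
    have "\<nu> p \<le> \<nu> n"
      using n by (intro monoD[OF \<open>mono \<nu>\<close>]) simp
    have "sqrt (tail_sq_sum a n) / \<nu> n \<le> sqrt (8 / (25 * real (K (Suc j)))) / \<nu> p"
      using tail[of n] n pos[of p] \<open>\<nu> p \<le> \<nu> n\<close> by (intro frac_le) auto
    then have "sqrt (tail_sq_sum a n) / \<nu> n * (1 / (real n * sqrt (ln (real n))))
        \<le> sqrt (8 / (25 * real (K (Suc j)))) / \<nu> p * (1 / (real n * sqrt (ln (real n))))"
      using n by (intro mult_right_mono) auto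
    then show "sqrt (tail_sq_sum a n) / (\<nu> n * real n * sqrt (ln (real n)))
        \<le> sqrt (8 / (25 * real (K (Suc j)))) / \<nu> p * (1 / (real n * sqrt (ln (real n))))"
      by (simp add: mult.assoc)
  qed
  also have "\<dots> = sqrt (8 / (25 * real (K (Suc j)))) / \<nu> p
      * (\<Sum>n\<in>{p<..q}. 1 / (real n * sqrt (ln (real n))))"
    by (rule sum_distrib_left[symmetric])
  also have "\<dots> \<le> sqrt (8 / (25 * real (K (Suc j)))) / \<nu> p * (2 * sqrt (ln (real q)))"
    using pos[of p] by (intro mult_left_mono sum_inverse_times_sqrt_ln_le) (auto simp: p_def)
  also have "\<dots> \<le> sqrt (8 / (25 * real (K (Suc j)))) / \<nu> p * (2 * sqrt (real (K (Suc j)) * ln 16))"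
  proof -
    have "ln (real q) = real (K (Suc j) - 1) * ln 16"
      by (simp add: q_def ln_realpow)
    then have "ln (real q) \<le> real (K (Suc j)) * ln 16"
      by (simp add: mult_right_mono)
    then show ?thesis
      using pos[of p] by (intro mult_left_mono) auto
  qed
  also have "\<dots> = 2 * sqrt (8/25 * ln 16) / \<nu> p"
    using Kpos by (simp add: real_sqrt_mult real_sqrt_divide field_simps)
  also have "\<dots> \<le> 2 * sqrt (8/25 * ln 16) / (\<nu> 1 * 2 ^ j)"
    using \<nu>p pos[of 1] pos[of p] by (intro divide_left_mono) auto
  also have "\<dots> = 2 * sqrt (8/25 * ln 16) / \<nu> 1 * (1/2) ^ j"
    by (simp add: power_one_over)
  finally show "(\<Sum>n\<in>{16 ^ (K j - 1)<..16 ^ (K (Suc j) - 1)}.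
        sqrt (tail_sq_sum a n) / (\<nu> n * real n * sqrt (ln (real n))))
      \<le> 2 * sqrt (8/25 * ln 16) / \<nu> 1 * (1/2) ^ j"
    unfolding p_def q_def .
qed

section \<open>Unbounded orthogonal polynomials\<close>

theorem theorem1p3:
  fixes \<nu> :: "nat \<Rightarrow> real"
  assumes "\<And>n. \<nu> n > 0"
    and "mono \<nu>"
    and "filterlim \<nu> at_top sequentially"
  shows "\<exists>(a :: nat \<Rightarrow> real) (M :: (nat \<Rightarrow> complex) measure)
            (\<omega> :: nat \<Rightarrow> (nat \<Rightarrow> complex) \<Rightarrow> complex).
     (\<forall>n. a n \<in> {-1<..<1}) \<and>
     prob_space M \<and>
     prob_space.indep_vars M (\<lambda>_. borel) \<omega> UNIV \<and>
     (\<forall>n. rotationally_symmetric M (\<omega> n)) \<and>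
     (\<forall>n. \<forall>x\<in>space M. \<omega> n x \<in> ball 0 1) \<and>
     (AE x in M. \<exists>\<theta>\<in>{0..<2*pi}.
        (SUP n. ereal (cmod (poly (opuc (\<lambda>k. complex_of_real (a k) * \<omega> k x) n)
                                  (exp (\<i> * complex_of_real \<theta>))))) = \<infinity>) \<and>
     (\<lambda>m. (a m)\<^sup>2) summable_on UNIV \<and>
     (\<lambda>n. sqrt (tail_sq_sum a n) / (\<nu> n * real n * sqrt (ln (real n)))) summable_on {2..}"
proof -
  obtain K :: "nat \<Rightarrow> nat" where K: "K 0 = 1" "strict_mono K" "\<And>j. 2 * K j \<le> K (Suc j)"
      "\<And>j. \<nu> 1 * 2 ^ j \<le> \<nu> (16 ^ (K j - 1))"
    using exists_sparse_scales[OF assms(3)] by blast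
  define d where "d = next_scale K"
  define a where "a = lacunary_coeff d"
  have d: "i < d i" for i
    unfolding d_def by (rule less_next_scale[OF K(2)])
  have a: "0 \<le> a n" "a n \<le> 2/5" for n
    unfolding a_def using lacunary_coeff_bounds[of d n] d by auto
  obtain M :: "(nat \<Rightarrow> complex) measure" and \<omega> :: "nat \<Rightarrow> (nat \<Rightarrow> complex) \<Rightarrow> complex"
    where M: "prob_space M" "prob_space.indep_vars M (\<lambda>_. borel) \<omega> UNIV"
      "\<And>n. rotationally_symmetric M (\<omega> n)" and \<omega>: "\<And>n x. cmod (\<omega> n x) = 1/2"
    using exists_independent_rotationally_symmetric by blast
  have unbounded: "\<exists>\<theta>\<in>{0..<2*pi}.
      (SUP n. ereal (cmod (poly (opuc (\<lambda>k. complex_of_real (a k) * \<omega> k x) n)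
                                (exp (\<i> * complex_of_real \<theta>))))) = \<infinity>" for x
  proof -
    define \<alpha> where "\<alpha> = (\<lambda>k. complex_of_real (a k) * \<omega> k x)"
    have norm_\<alpha>: "cmod (\<alpha> k) = a k / 2" for k
      using a(1)[of k] by (simp add: \<alpha>_def norm_mult \<omega>)
    have "\<exists>\<theta>\<in>{0..<2*pi}. (SUP n. ereal (cmod (poly (opuc \<alpha> n) (cis \<theta>)))) = \<infinity>"
    proof (rule opuc_lacunary_unbounded[where N = "\<lambda>i. 16 ^ i"])
      show "cmod (\<alpha> n) \<le> 1/5" for n
        using a(2)[of n] by (simp add: norm_\<alpha>)
      show "{n. \<alpha> n \<noteq> 0} \<subseteq> range (\<lambda>i. 16 ^ i)"
        by (auto simp: \<alpha>_def a_def lacunary_coeff_def split: if_splits)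
      have "(\<lambda>i. cmod (\<alpha> (16 ^ i))) = (\<lambda>i. (1/5) / real (next_scale K i))"
        by (simp add: norm_\<alpha> a_def lacunary_coeff_power d_def)
      then show "\<not> summable (\<lambda>i. cmod (\<alpha> (16 ^ i)))"
        using not_summable_inverse_next_scale[OF K(2,3), of "1/5"] by simp
    qed simp_all
    then show ?thesis by (simp only: \<alpha>_def cis_conv_exp)
  qed
  show ?thesis
  proof (intro exI conjI allI ballI)
    show "a n \<in> {-1<..<1}" for n
      using a[of n] by auto
    show "\<omega> n x \<in> ball 0 1" for n x
      by (simp add: \<omega>)
    show "AE x in M. \<exists>\<theta>\<in>{0..<2*pi}.
        (SUP n. ereal (cmod (poly (opuc (\<lambda>k. complex_of_real (a k) * \<omega> k x) n)
                                  (exp (\<i> * complex_of_real \<theta>))))) = \<infinity>"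
      by (rule AE_I2) (rule unbounded)
    show "(\<lambda>m. (a m)\<^sup>2) summable_on UNIV"
      unfolding a_def by (rule summable_lacunary_coeff_squares) (rule d)
    show "(\<lambda>n. sqrt (tail_sq_sum a n) / (\<nu> n * real n * sqrt (ln (real n)))) summable_on {2..}"
      unfolding a_def d_def by (rule weighted_tail_summable[OF assms(1,2) K(1,2,4)])
  qed (fact M)+
qed

end
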